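(* Let $k$ be an algebraically closed field of characteristic zero and let $X=V(f)\subset\mathbb{P}^1$ be a reduced hypersurface of degree $d$ ($d\geq 1$) over $k$. Then $X=V(f)$ has vanishing Hessian (i.e. $h_f\equiv 0$) if and only if $X$ is a cone. In this case $d=1$ and $X$ is a point.
   Context: For homogeneous $f\in k[x_0,\ldots,x_n]$ the Hessian polynomial is $h_f:=\det\left(\frac{\partial^2 f}{\partial x_i\partial x_j}\right)_{i,j=0,\ldots,n}$. A hypersurface $X=V(f)\subset\mathbb{P}^n$ is a cone if, modulo projective transformations of $\mathbb{P}^n$, the equation defining $X$ does not depend on all the variables. *)

theory Defs
  imports
    "HOL-Analysis.Analysis"
    "HOL-Computational_Algebra.Computational_Algebra"
    "HOL-Library.Poly_Mapping"
begin

text \<open>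
  A polynomial is a finitely supported map from exponent vectors to coefficients. The finite
  index type \<open>'n\<close> plays the role of \<open>{0, \<dots>, n}\<close>, so that \<open>CARD('n) = n + 1\<close>;
  the homogeneous coordinate ring of the projective line is \<open>(2, 'a) mpoly\<close>.
\<close>

type_synonym ('n, 'a) mpoly = "('n \<Rightarrow>\<^sub>0 nat) \<Rightarrow>\<^sub>0 'a"

definition mvar :: "'n \<Rightarrow> ('n, 'a::zero_neq_one) mpoly" where
  "mvar i = Poly_Mapping.single (Poly_Mapping.single i 1) 1"

definition mconst :: "'a \<Rightarrow> ('n, 'a::zero) mpoly" where
  "mconst c = Poly_Mapping.single 0 c"

definition homogeneous :: "nat \<Rightarrow> ('n::finite, 'a::zero) mpoly \<Rightarrow> bool" where
  "homogeneous d f \<longleftrightarrow>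
     (\<forall>m \<in> Poly_Mapping.keys f. (\<Sum>i\<in>UNIV. Poly_Mapping.lookup m i) = d)"

definition depends_on :: "('n, 'a::zero) mpoly \<Rightarrow> 'n \<Rightarrow> bool" where
  "depends_on f i \<longleftrightarrow> (\<exists>m \<in> Poly_Mapping.keys f. Poly_Mapping.lookup m i \<noteq> 0)"

definition meval :: "('n::finite, 'a::comm_ring_1) mpoly \<Rightarrow> 'a ^ 'n \<Rightarrow> 'a" where
  "meval f v = (\<Sum>m \<in> Poly_Mapping.keys f.
     Poly_Mapping.lookup f m * (\<Prod>i\<in>UNIV. v $ i ^ Poly_Mapping.lookup m i))"

text \<open>
  The truncated subtraction of exponents is harmless: a monomial not involving \<open>x\<^sub>i\<close>
  gets the coefficient \<open>0\<close>.
\<close>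

definition mpderiv :: "'n \<Rightarrow> ('n, 'a::comm_ring_1) mpoly \<Rightarrow> ('n, 'a) mpoly" where
  "mpderiv i f = (\<Sum>m \<in> Poly_Mapping.keys f.
     Poly_Mapping.single (m - Poly_Mapping.single i 1)
       (of_nat (Poly_Mapping.lookup m i) * Poly_Mapping.lookup f m))"

definition hessian :: "('n::finite, 'a::comm_ring_1) mpoly \<Rightarrow> ('n, 'a) mpoly" where
  "hessian f = det (\<chi> i j. mpderiv i (mpderiv j f))"

text \<open>The polynomial \<open>f(A x)\<close>, i.e. \<open>f\<close> with \<open>\<Sum>\<^sub>j A\<^sub>i\<^sub>j x\<^sub>j\<close> substituted for \<open>x\<^sub>i\<close>.\<close>

definition linear_subst ::
  "'a ^ 'n ^ 'n \<Rightarrow> ('n::finite, 'a::comm_ring_1) mpoly \<Rightarrow> ('n, 'a) mpoly" where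
  "linear_subst A f = (\<Sum>m \<in> Poly_Mapping.keys f.
     mconst (Poly_Mapping.lookup f m) *
     (\<Prod>i\<in>UNIV. (\<Sum>j\<in>UNIV. mconst (A $ i $ j) * mvar j) ^ Poly_Mapping.lookup m i))"

definition is_cone :: "('n::finite, 'a::field) mpoly \<Rightarrow> bool" where
  "is_cone f \<longleftrightarrow>
     (\<exists>A :: 'a ^ 'n ^ 'n. invertible A \<and> (\<exists>i. \<not> depends_on (linear_subst A f) i))"

text \<open>Points of projective space are the lines through the origin of \<open>'a ^ 'n\<close>.\<close>

definition proj_space :: "('a::field ^ 'n::finite) set set" where
  "proj_space = {vec.span {v} | v. v \<noteq> 0}"

definition zero_locus :: "('n::finite, 'a::field) mpoly \<Rightarrow> ('a ^ 'n) set set" where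
  "zero_locus f = {P \<in> proj_space. \<forall>v \<in> P. meval f v = 0}"

end

theory Submission
  imports Defs
begin

text \<open>
  A binary form \<open>f\<close> of degree \<open>d \<ge> 1\<close> has a nontrivial zero \<open>v\<close>, hence is divisible by the linear
  form vanishing at \<open>v\<close>. If the Hessian vanishes and \<open>d \<ge> 2\<close>, Euler's relations force the
  gradient of \<open>f\<close> to vanish at \<open>v\<close>, so the square of that linear form divides \<open>f\<close>. If \<open>f\<close> is a
  cone, it is a constant times the \<open>d\<close>-th power of a linear form. In both cases squarefreeness
  leaves only \<open>d = 1\<close>, and for a nonzero linear form everything is explicit.
\<close>

section \<open>Substitution homomorphisms\<close>

lemma mpoly_sum_monomials:
  "(\<Sum>m\<in>Poly_Mapping.keys f. Poly_Mapping.single m (Poly_Mapping.lookup f m)) = f"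
  by (rule poly_mapping_eqI) (auto simp: lookup_sum lookup_single when_def in_keys_iff)

text \<open>Reduces additive and bilinear identities to monomials. The empty sum falls under the
  \<open>single\<close> case with coefficient 0.\<close>

lemma poly_mapping_induct [case_names single add]:
  fixes f :: "'a \<Rightarrow>\<^sub>0 'b::comm_monoid_add"
  assumes single: "\<And>m c. P (Poly_Mapping.single m c)"
    and add: "\<And>f g. P f \<Longrightarrow> P g \<Longrightarrow> P (f + g)"
  shows "P f"
proof -
  have "P (\<Sum>m\<in>S. Poly_Mapping.single m (Poly_Mapping.lookup f m))" for S
    using single[of undefined 0]
    by (induction S rule: infinite_finite_induct) (simp_all add: single add)
  from this[of "Poly_Mapping.keys f"] show ?thesis
    by (simp add: mpoly_sum_monomials)
qed

text \<open>Evaluation and linear substitution are the same construction: coefficients pass through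
  a ring homomorphism \<open>h\<close> and variables are replaced by ring elements. Taking
  \<open>h\<close> to be the identity gives \<open>meval\<close>, taking \<open>mconst\<close> gives
  \<open>linear_subst\<close>, so the homomorphism laws are proved once for both.\<close>

locale coefficient_hom =
  fixes h :: "'a::comm_ring_1 \<Rightarrow> 'b::comm_ring_1"
  assumes hom_zero: "h 0 = 0"
    and hom_one: "h 1 = 1"
    and hom_add: "h (a + b) = h a + h b"
    and hom_mult: "h (a * b) = h a * h b"
begin

definition msubst :: "('n::finite \<Rightarrow> 'b) \<Rightarrow> ('n, 'a) mpoly \<Rightarrow> 'b" where
  "msubst s f = (\<Sum>m \<in> Poly_Mapping.keys f.
     h (Poly_Mapping.lookup f m) * (\<Prod>i\<in>UNIV. s i ^ Poly_Mapping.lookup m i))"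

text \<open>Cancellation makes the support of a sum unpredictable. Summing over a common finite
  superset avoids this, the extra terms vanishing because \<open>h 0 = 0\<close>.\<close>

lemma msubst_superset:
  assumes "finite S" "Poly_Mapping.keys f \<subseteq> S"
  shows "msubst s f = (\<Sum>m \<in> S.
     h (Poly_Mapping.lookup f m) * (\<Prod>i\<in>UNIV. s i ^ Poly_Mapping.lookup m i))"
  unfolding msubst_def
  by (rule sum.mono_neutral_left) (use assms in \<open>auto simp: in_keys_iff hom_zero\<close>)

lemma msubst_zero [simp]: "msubst s 0 = 0"
  by (simp add: msubst_def)

lemma msubst_add: "msubst s (f + g) = msubst s f + msubst s g"
proof -
  let ?S = "Poly_Mapping.keys f \<union> Poly_Mapping.keys g"
  have "Poly_Mapping.keys (f + g) \<subseteq> ?S"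
    by (rule Poly_Mapping.keys_add)
  then show ?thesis
    by (simp add: msubst_superset[of ?S] lookup_add hom_add distrib_right sum.distrib)
qed

lemma msubst_single:
  "msubst s (Poly_Mapping.single m c) = h c * (\<Prod>i\<in>UNIV. s i ^ Poly_Mapping.lookup m i)"
  by (simp add: msubst_superset[of "{m}"])

lemma msubst_sum: "msubst s (\<Sum>x\<in>A. F x) = (\<Sum>x\<in>A. msubst s (F x))"
  by (induction A rule: infinite_finite_induct) (simp_all add: msubst_add)

text \<open>Both sides are biadditive, so it suffices to treat two monomials, whose exponents add
  under multiplication.\<close>

lemma msubst_mult: "msubst s (f * g) = msubst s f * msubst s g"
proof (induction f rule: poly_mapping_induct)
  case (single m c)
  show ?case
  proof (induction g rule: poly_mapping_induct)
    case (single n e)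
    show ?case
      by (simp add: mult_single msubst_single hom_mult lookup_add power_add prod.distrib algebra_simps)
  next
    case (add g1 g2)
    then show ?case by (simp add: msubst_add distrib_left)
  qed
next
  case (add f1 f2)
  then show ?case by (simp add: msubst_add distrib_right)
qed

lemma msubst_one: "msubst s 1 = 1"
  by (simp add: msubst_single hom_one flip: single_one)

lemma msubst_power: "msubst s (f ^ k) = msubst s f ^ k"
  by (induction k) (simp_all add: msubst_one msubst_mult)

lemma msubst_prod: "msubst s (\<Prod>x\<in>A. F x) = (\<Prod>x\<in>A. msubst s (F x))"
  by (induction A rule: infinite_finite_induct) (simp_all add: msubst_one msubst_mult)

lemma msubst_mconst: "msubst s (mconst c) = h c"
  by (simp add: mconst_def msubst_single)

lemma msubst_mvar: "msubst s (mvar i) = s i"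
proof -
  have "(\<Prod>k\<in>UNIV. s k ^ Poly_Mapping.lookup (Poly_Mapping.single i (1::nat)) k)
      = (\<Prod>k\<in>UNIV. if k = i then s k else 1)"
    by (intro prod.cong) (auto simp: lookup_single when_def)
  then show ?thesis
    by (simp add: mvar_def msubst_single hom_one)
qed

end

lemma mconst_zero [simp]: "mconst 0 = 0"
  and mconst_one [simp]: "mconst 1 = 1"
  and mconst_add: "mconst (a + b) = mconst a + mconst b"
  and mconst_mult: "mconst (a * b) = mconst a * mconst b"
  for a b :: "'a::comm_ring_1"
  by (simp_all add: mconst_def single_add mult_single)

lemma mconst_sum: "mconst (\<Sum>x\<in>S. F x) = (\<Sum>x\<in>S. mconst (F x))"
  for F :: "'i \<Rightarrow> 'a::comm_ring_1"
  by (induction S rule: infinite_finite_induct) (simp_all add: mconst_add)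

interpretation value_hom: coefficient_hom "\<lambda>x::'a::comm_ring_1. x"
  by unfold_locales simp_all

interpretation const_hom: coefficient_hom "mconst :: 'a::comm_ring_1 \<Rightarrow> ('n::finite, 'a) mpoly"
  by unfold_locales (simp_all add: mconst_add mconst_mult)

lemma meval_eq_msubst: "meval f v = value_hom.msubst (($) v) f"
  by (simp add: meval_def value_hom.msubst_def)

lemma linear_subst_eq_msubst:
  "linear_subst A f = const_hom.msubst (\<lambda>i. \<Sum>j\<in>UNIV. mconst (A $ i $ j) * mvar j) f"
  by (simp add: linear_subst_def const_hom.msubst_def)

lemma meval_add: "meval (f + g) v = meval f v + meval g v"
  and meval_mult: "meval (f * g) v = meval f v * meval g v"
  and meval_power: "meval (f ^ k) v = meval f v ^ k"
  and meval_zero: "meval 0 v = 0"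
  and meval_one: "meval 1 v = 1"
  and meval_mconst: "meval (mconst c) v = c"
  and meval_mvar: "meval (mvar i) v = v $ i"
  and meval_sum: "meval (\<Sum>x\<in>S. F x) v = (\<Sum>x\<in>S. meval (F x) v)"
  by (simp_all add: meval_eq_msubst value_hom.msubst_add value_hom.msubst_mult
      value_hom.msubst_power value_hom.msubst_one value_hom.msubst_mconst
      value_hom.msubst_mvar value_hom.msubst_sum)

lemma meval_diff: "meval (f - g) v = meval f v - meval g v"
  using meval_add[of "f - g" g v] by simp

lemmas meval_simps = meval_add meval_diff meval_mult meval_power meval_zero meval_one
  meval_mconst meval_mvar meval_sum

lemma linear_subst_add: "linear_subst A (f + g) = linear_subst A f + linear_subst A g"
  and linear_subst_mult: "linear_subst A (f * g) = linear_subst A f * linear_subst A g"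
  and linear_subst_power: "linear_subst A (f ^ k) = linear_subst A f ^ k"
  and linear_subst_mconst: "linear_subst A (mconst c) = mconst c"
  and linear_subst_mvar: "linear_subst A (mvar i) = (\<Sum>j\<in>UNIV. mconst (A $ i $ j) * mvar j)"
  and linear_subst_sum: "linear_subst A (\<Sum>x\<in>S. F x) = (\<Sum>x\<in>S. linear_subst A (F x))"
  and linear_subst_prod: "linear_subst A (\<Prod>x\<in>S. F x) = (\<Prod>x\<in>S. linear_subst A (F x))"
  by (simp_all add: linear_subst_eq_msubst const_hom.msubst_add const_hom.msubst_mult
      const_hom.msubst_power const_hom.msubst_mconst
      const_hom.msubst_mvar const_hom.msubst_sum const_hom.msubst_prod)

lemma linear_subst_diff: "linear_subst A (f - g) = linear_subst A f - linear_subst A g"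
  using linear_subst_add[of A "f - g" g] by simp

lemmas linear_subst_simps = linear_subst_add linear_subst_diff linear_subst_mult
  linear_subst_power linear_subst_mconst linear_subst_mvar linear_subst_sum linear_subst_prod

lemma mvar_power: "mvar i ^ k = Poly_Mapping.single (Poly_Mapping.single i k) (1::'a::comm_ring_1)"
proof (induction k)
  case (Suc k)
  then show ?case
    by (simp add: mvar_def mult_single flip: single_add)
qed simp

lemma prod_mvar_power:
  "(\<Prod>i\<in>UNIV. mvar i ^ Poly_Mapping.lookup m i) = Poly_Mapping.single m (1::'a::comm_ring_1)"
  for m :: "'n::finite \<Rightarrow>\<^sub>0 nat"
proof -
  have "(\<Prod>i\<in>S. mvar i ^ Poly_Mapping.lookup m i)
      = Poly_Mapping.single (\<Sum>i\<in>S. Poly_Mapping.single i (Poly_Mapping.lookup m i)) (1::'a)"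
    if "finite S" for S
    using that by induction (simp_all add: mvar_power mult_single)
  moreover have "(\<Sum>i\<in>UNIV. Poly_Mapping.single i (Poly_Mapping.lookup m i)) = m"
    by (rule poly_mapping_eqI) (simp add: lookup_sum lookup_single when_def)
  ultimately show ?thesis by simp
qed

lemma single_eq_mconst_mult: "Poly_Mapping.single m c = mconst c * Poly_Mapping.single m (1::'a::comm_ring_1)"
  by (simp add: mconst_def mult_single)

text \<open>Replacing \<open>x\<close> by \<open>B x\<close> in \<open>f(A x)\<close> gives
  \<open>f(A (B x))\<close>, hence the order of the factors. With \<open>linear_subst_mat_1\<close>
  this makes an invertible change of coordinates reversible.\<close>

lemma linear_subst_linear_subst:
  "linear_subst B (linear_subst A f) = linear_subst (A ** B) f"
proof -
  have "(\<Sum>j\<in>UNIV. mconst (A $ i $ j) * (\<Sum>k\<in>UNIV. mconst (B $ j $ k) * mvar k))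
      = (\<Sum>k\<in>UNIV. mconst ((A ** B) $ i $ k) * mvar k)" for i
  proof -
    have "(\<Sum>k\<in>UNIV. mconst ((A ** B) $ i $ k) * mvar k)
        = (\<Sum>k\<in>UNIV. \<Sum>j\<in>UNIV. mconst (A $ i $ j) * (mconst (B $ j $ k) * mvar k))"
      by (simp add: matrix_matrix_mult_def mconst_sum mconst_mult sum_distrib_right mult.assoc)
    also have "\<dots> = (\<Sum>j\<in>UNIV. \<Sum>k\<in>UNIV. mconst (A $ i $ j) * (mconst (B $ j $ k) * mvar k))"
      by (rule sum.swap)
    finally show ?thesis by (simp add: sum_distrib_left)
  qed
  then show ?thesis
    by (simp add: linear_subst_def[of A f] linear_subst_def[of "A ** B" f] linear_subst_simps)
qed

lemma linear_subst_mat_1: "linear_subst (mat 1) f = f"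
  for f :: "('n::finite, 'a::comm_ring_1) mpoly"
proof -
  have "(\<Sum>j\<in>UNIV. mconst (mat 1 $ i $ j) * mvar j) = (mvar i :: ('n, 'a) mpoly)" for i
    by (simp add: mat_def if_distrib[of mconst] if_distrib[of "\<lambda>x. x * _"] cong: if_cong)
  then show ?thesis
    by (simp add: linear_subst_def prod_mvar_power mpoly_sum_monomials flip: single_eq_mconst_mult)
qed

section \<open>Homogeneous polynomials\<close>

lemma homogeneous_zero [simp]: "homogeneous d 0"
  by (simp add: homogeneous_def)

lemma homogeneous_add: "homogeneous d f \<Longrightarrow> homogeneous d g \<Longrightarrow> homogeneous d (f + g)"
  using Poly_Mapping.keys_add[of f g] by (auto simp: homogeneous_def)

lemma homogeneous_sum:
  "(\<And>x. x \<in> S \<Longrightarrow> homogeneous d (F x)) \<Longrightarrow> homogeneous d (\<Sum>x\<in>S. F x)"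
  by (induction S rule: infinite_finite_induct) (simp_all add: homogeneous_add)

lemma homogeneous_mult:
  assumes "homogeneous d f" "homogeneous e g"
  shows "homogeneous (d + e) (f * g)"
  using assms keys_mult[of f g]
  by (fastforce simp: homogeneous_def lookup_add sum.distrib)

lemma homogeneous_single:
  "(\<Sum>i\<in>UNIV. Poly_Mapping.lookup m i) = d \<Longrightarrow> homogeneous d (Poly_Mapping.single m c)"
  by (simp add: homogeneous_def)

lemma homogeneous_mconst: "homogeneous 0 (mconst c)"
  by (simp add: mconst_def homogeneous_single)

lemma homogeneous_mvar: "homogeneous 1 (mvar i)"
  by (simp add: mvar_def homogeneous_single lookup_single when_def)

lemma homogeneous_one: "homogeneous 0 (1 :: ('n::finite, 'a::comm_ring_1) mpoly)"
  using homogeneous_mconst[of "1::'a"] by simp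

lemma homogeneous_power: "homogeneous d f \<Longrightarrow> homogeneous (k * d) (f ^ k)"
  for f :: "('n::finite, 'a::comm_ring_1) mpoly"
  by (induction k) (simp_all add: homogeneous_one homogeneous_mult)

lemma homogeneous_prod:
  "(\<And>x. x \<in> S \<Longrightarrow> homogeneous (e x) (F x)) \<Longrightarrow> homogeneous (\<Sum>x\<in>S. e x) (\<Prod>x\<in>S. F x)"
  for F :: "'i \<Rightarrow> ('n::finite, 'a::comm_ring_1) mpoly"
  by (induction S rule: infinite_finite_induct) (simp_all add: homogeneous_one homogeneous_mult)

lemma homogeneous_linear_subst:
  assumes "homogeneous d f"
  shows "homogeneous d (linear_subst A f)"
  unfolding linear_subst_def
proof (rule homogeneous_sum)
  fix m assume m: "m \<in> Poly_Mapping.keys f"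
  have lin: "homogeneous 1 (\<Sum>j\<in>UNIV. mconst (A $ i $ j) * mvar j)" for i
    using homogeneous_mult[OF homogeneous_mconst homogeneous_mvar]
    by (intro homogeneous_sum) simp
  \<comment> \<open>A monomial of degree \<open>d\<close> becomes a product of \<open>d\<close>
    linear forms. The factor 1 is the degree of each of them, kept so that the power rule
    matches.\<close>
  have "homogeneous (\<Sum>i\<in>UNIV. Poly_Mapping.lookup m i * 1)
      (\<Prod>i\<in>UNIV. (\<Sum>j\<in>UNIV. mconst (A $ i $ j) * mvar j) ^ Poly_Mapping.lookup m i)"
    by (intro homogeneous_prod homogeneous_power lin)
  moreover have "(\<Sum>i\<in>UNIV. Poly_Mapping.lookup m i * 1) = d"
    using assms m by (simp add: homogeneous_def)
  ultimately show "homogeneous d (mconst (Poly_Mapping.lookup f m) *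
      (\<Prod>i\<in>UNIV. (\<Sum>j\<in>UNIV. mconst (A $ i $ j) * mvar j) ^ Poly_Mapping.lookup m i))"
    using homogeneous_mult[OF homogeneous_mconst] by fastforce
qed

lemma homogeneous_0_iff: "homogeneous 0 f \<longleftrightarrow> (\<exists>c. f = mconst c)"
proof
  assume "homogeneous 0 f"
  then have "Poly_Mapping.keys f \<subseteq> {0}"
    by (auto simp: homogeneous_def intro!: poly_mapping_eqI)
  then have "f = mconst (Poly_Mapping.lookup f 0)"
    by (intro poly_mapping_eqI) (auto simp: mconst_def lookup_single when_def in_keys_iff)
  then show "\<exists>c. f = mconst c" ..
qed (auto simp: homogeneous_mconst)

section \<open>Partial derivatives\<close>

lemma mpderiv_superset:
  assumes "finite S" "Poly_Mapping.keys f \<subseteq> S"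
  shows "mpderiv i f = (\<Sum>m \<in> S. Poly_Mapping.single (m - Poly_Mapping.single i 1)
       (of_nat (Poly_Mapping.lookup m i) * Poly_Mapping.lookup f m))"
  unfolding mpderiv_def
  by (rule sum.mono_neutral_left) (use assms in \<open>auto simp: in_keys_iff\<close>)

lemma mpderiv_zero [simp]: "mpderiv i 0 = 0"
  by (simp add: mpderiv_def)

lemma mpderiv_add: "mpderiv i (f + g) = mpderiv i f + mpderiv i g"
proof -
  let ?S = "Poly_Mapping.keys f \<union> Poly_Mapping.keys g"
  have "Poly_Mapping.keys (f + g) \<subseteq> ?S"
    by (rule Poly_Mapping.keys_add)
  then show ?thesis
    by (simp add: mpderiv_superset[of ?S] lookup_add distrib_left single_add sum.distrib)
qed

lemma mpderiv_diff: "mpderiv i (f - g) = mpderiv i f - mpderiv i g"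
  using mpderiv_add[of i "f - g" g] by simp

lemma mpderiv_single:
  "mpderiv i (Poly_Mapping.single m c)
    = Poly_Mapping.single (m - Poly_Mapping.single i 1) (of_nat (Poly_Mapping.lookup m i) * c)"
  by (simp add: mpderiv_superset[of "{m}"])

lemma mpderiv_mult: "mpderiv i (f * g) = mpderiv i f * g + f * mpderiv i g"
proof (induction f rule: poly_mapping_induct)
  case (single m c)
  show ?case
  proof (induction g rule: poly_mapping_induct)
    case (single n e)
    \<comment> \<open>Exponents are subtracted with truncation, so this needs \<open>x_i\<close> to
      occur in \<open>m\<close>. Otherwise the coefficient in the next fact is 0 and the exponent is
      irrelevant.\<close>
    have *: "m - Poly_Mapping.single i 1 + n = m + n - Poly_Mapping.single i 1"
      if "Poly_Mapping.lookup m i \<noteq> 0" for m n :: "'a \<Rightarrow>\<^sub>0 nat"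
      using that by (intro poly_mapping_eqI) (auto simp: lookup_add lookup_minus lookup_single when_def)
    have **: "Poly_Mapping.single (m - Poly_Mapping.single i 1 + n) (of_nat (Poly_Mapping.lookup m i) * x)
        = Poly_Mapping.single (m + n - Poly_Mapping.single i 1) (of_nat (Poly_Mapping.lookup m i) * x)"
      for m n :: "'a \<Rightarrow>\<^sub>0 nat" and x :: 'b
    proof (cases "Poly_Mapping.lookup m i = 0")
      case False
      then show ?thesis by (subst *) simp_all
    qed simp
    show ?case
      using **[of m n "c * e"] **[of n m "c * e"]
      by (simp add: mult_single mpderiv_single lookup_add algebra_simps flip: single_add)
  next
    case (add g1 g2)
    then show ?case by (simp add: mpderiv_add algebra_simps)
  qed
next
  case (add f1 f2)
  then show ?case by (simp add: mpderiv_add algebra_simps)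
qed

lemma mpderiv_mconst: "mpderiv i (mconst c) = 0"
  by (simp add: mconst_def mpderiv_single)

lemma mpderiv_mvar: "mpderiv i (mvar j) = (if i = j then 1 else 0)"
  by (simp add: mvar_def mpderiv_single lookup_single when_def)

lemma mpderiv_commute: "mpderiv i (mpderiv j f) = mpderiv j (mpderiv i f)"
proof (induction f rule: poly_mapping_induct)
  case (single m c)
  have "m - Poly_Mapping.single j 1 - Poly_Mapping.single i 1
      = m - Poly_Mapping.single i 1 - Poly_Mapping.single j 1"
    by (rule poly_mapping_eqI) (simp add: lookup_minus)
  then show ?case
    by (cases "i = j")
      (simp_all add: mpderiv_single lookup_minus lookup_single when_def mult.left_commute)
next
  case (add f1 f2)
  then show ?case by (simp add: mpderiv_add)
qed

lemma homogeneous_mpderiv: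
  assumes "homogeneous (Suc d) f"
  shows "homogeneous d (mpderiv i f)"
  unfolding mpderiv_def
proof (rule homogeneous_sum)
  fix m assume m: "m \<in> Poly_Mapping.keys f"
  show "homogeneous d (Poly_Mapping.single (m - Poly_Mapping.single i 1)
       (of_nat (Poly_Mapping.lookup m i) * Poly_Mapping.lookup f m))"
  proof (cases "Poly_Mapping.lookup m i = 0")
    case False
    have "(\<Sum>k\<in>UNIV. Poly_Mapping.lookup m k)
        = (\<Sum>k\<in>UNIV. Poly_Mapping.lookup (m - Poly_Mapping.single i 1) k + (if k = i then 1 else 0))"
      using False by (intro sum.cong) (auto simp: lookup_minus lookup_single when_def)
    also have "\<dots> = Suc (\<Sum>k\<in>UNIV. Poly_Mapping.lookup (m - Poly_Mapping.single i 1) k)"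
      by (simp add: sum.distrib)
    finally show ?thesis
      using assms m by (intro homogeneous_single) (simp add: homogeneous_def)
  qed simp
qed

lemma euler_homogeneous:
  fixes f :: "('n::finite, 'a::comm_ring_1) mpoly"
  assumes "homogeneous d f"
  shows "(\<Sum>i\<in>UNIV. mvar i * mpderiv i f) = of_nat d * f"
proof -
  \<comment> \<open>Multiplication by \<open>x_i\<close> restores the exponent lowered by the
    derivative and leaves the factor \<open>m_i\<close>. Summed over \<open>i\<close>, these factors
    give the degree.\<close>
  have *: "mvar i * Poly_Mapping.single (m - Poly_Mapping.single i 1) (of_nat (Poly_Mapping.lookup m i) * c)
      = of_nat (Poly_Mapping.lookup m i) * Poly_Mapping.single m c"
    for i :: 'n and m and c :: 'a
  proof (cases "Poly_Mapping.lookup m i = 0")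
    case False
    then have "Poly_Mapping.single i 1 + (m - Poly_Mapping.single i 1) = m"
      by (intro poly_mapping_eqI) (auto simp: lookup_add lookup_minus lookup_single when_def)
    then show ?thesis
      by (simp add: mvar_def mult_single flip: single_of_nat)
  qed simp
  have "(\<Sum>i\<in>UNIV. mvar i * mpderiv i f)
      = (\<Sum>m\<in>Poly_Mapping.keys f. \<Sum>i\<in>UNIV. of_nat (Poly_Mapping.lookup m i)
          * Poly_Mapping.single m (Poly_Mapping.lookup f m))"
    unfolding mpderiv_def sum_distrib_left * by (rule sum.swap)
  also have "\<dots> = (\<Sum>m\<in>Poly_Mapping.keys f. of_nat d * Poly_Mapping.single m (Poly_Mapping.lookup f m))"
    using assms by (intro sum.cong) (simp_all add: homogeneous_def flip: sum_distrib_right of_nat_sum)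
  also have "\<dots> = of_nat d * f"
    by (simp add: mpoly_sum_monomials flip: sum_distrib_left)
  finally show ?thesis .
qed

section \<open>Binary forms\<close>

lemma UNIV_2_eq: "i \<noteq> j \<Longrightarrow> UNIV = {i, j}" for i j :: 2
  using exhaust_2[of i] exhaust_2[of j] by (auto simp: UNIV_2)

lemma sum_UNIV_2: "i \<noteq> j \<Longrightarrow> (\<Sum>k\<in>UNIV. F k) = F i + F j" for i j :: 2
  by (simp add: UNIV_2_eq)

lemma prod_UNIV_2: "i \<noteq> j \<Longrightarrow> (\<Prod>k\<in>UNIV. F k) = F i * F j" for i j :: 2
  by (simp add: UNIV_2_eq)

section \<open>Division by the linear form of a point, and zeros of binary forms\<close>

definition line_form :: "2 \<Rightarrow> 2 \<Rightarrow> 'a::comm_ring_1 ^ 2 \<Rightarrow> (2, 'a) mpoly" where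
  "line_form i j v = mconst (v $ i) * mvar j - mconst (v $ j) * mvar i"

text \<open>For distinct \<open>i\<close> and \<open>j\<close> this is, up to sign, the determinant
  with columns \<open>v\<close> and \<open>w\<close>. In particular the form vanishes at
  \<open>v\<close>. Leaving the indices free allows \<open>i\<close> to be a coordinate with
  \<open>v $ i\<close> nonzero.\<close>

lemma meval_line_form: "meval (line_form i j v) w = v $ i * w $ j - v $ j * w $ i"
  by (simp add: line_form_def meval_simps)

text \<open>Modulo the line form, \<open>v_i x_j\<close> equals \<open>v_j x_i\<close>. As
  \<open>v_i\<close> is invertible, each factor \<open>x_j\<close> can be traded for a multiple of
  \<open>x_i\<close> until only a power of \<open>x_i\<close> remains.\<close>

lemma monomial_mod_line_form:
  fixes v :: "'a::field ^ 2"
  assumes "v $ i \<noteq> 0" "a + b = Suc d"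
  shows "\<exists>q c. homogeneous d q \<and>
    mvar j ^ a * mvar i ^ b = line_form i j v * q + mconst c * mvar i ^ Suc d"
  using assms(2)
proof (induction a arbitrary: b)
  case 0
  then show ?case
    by (intro exI[of _ 0] exI[of _ 1]) simp
next
  case (Suc a)
  then obtain q c where q: "homogeneous d q"
    "mvar j ^ a * mvar i ^ Suc b = line_form i j v * q + mconst c * mvar i ^ Suc d"
    by (metis add_Suc_shift)
  \<comment> \<open>With \<open>L\<close> the line form, \<open>x_j = (L + v_j x_i) / v_i\<close>.
    Trading one \<open>x_j\<close> this way produces the first summand as cofactor of
    \<open>L\<close>; the induction hypothesis for \<open>b + 1\<close> supplies the second.\<close>
  define q' where "q' = mconst (1 / v $ i) * (mvar j ^ a * mvar i ^ b) + mconst (v $ j / v $ i) * q"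
  have "homogeneous (0 + (a * 1 + b * 1)) (mconst (1 / v $ i) * (mvar j ^ a * mvar i ^ b))"
    by (intro homogeneous_mult homogeneous_mconst homogeneous_power homogeneous_mvar)
  moreover have "homogeneous (0 + d) (mconst (v $ j / v $ i) * q)"
    by (intro homogeneous_mult homogeneous_mconst q)
  ultimately have "homogeneous d q'"
    using Suc.prems unfolding q'_def by (intro homogeneous_add) simp_all
  moreover have "mvar j ^ Suc a * mvar i ^ b
      = line_form i j v * q' + mconst (v $ j / v $ i * c) * mvar i ^ Suc d"
  proof -
    have 1: "mconst (1 / v $ i) * mconst (v $ i) = (1 :: (2, 'a) mpoly)"
      using assms(1) by (simp flip: mconst_mult)
    have 2: "mconst (v $ j / v $ i) = mconst (1 / v $ i) * (mconst (v $ j) :: (2, 'a) mpoly)"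
      by (simp flip: mconst_mult)
    have "line_form i j v * q' + mconst (v $ j / v $ i * c) * mvar i ^ Suc d
       = line_form i j v * mconst (1 / v $ i) * (mvar j ^ a * mvar i ^ b)
          + mconst (v $ j / v $ i) * (line_form i j v * q + mconst c * mvar i ^ Suc d)"
      unfolding q'_def mconst_mult[of _ c] by (simp add: algebra_simps)
    also have "\<dots> = line_form i j v * mconst (1 / v $ i) * (mvar j ^ a * mvar i ^ b)
          + mconst (v $ j / v $ i) * (mvar j ^ a * mvar i ^ Suc b)"
      by (simp only: q(2))
    also have "\<dots> = (mconst (1 / v $ i) * mconst (v $ i)) * (mvar j ^ Suc a * mvar i ^ b)"
      by (simp add: 2 line_form_def algebra_simps)
    finally show ?thesis by (simp add: 1)
  qed
  ultimately show ?case by blast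
qed

lemma homogeneous_mod_line_form:
  fixes f :: "(2, 'a::field) mpoly" and v :: "'a ^ 2"
  assumes "homogeneous (Suc d) f" "i \<noteq> j" "v $ i \<noteq> 0"
  shows "\<exists>q c. homogeneous d q \<and> f = line_form i j v * q + mconst c * mvar i ^ Suc d"
proof -
  have "\<exists>q c. homogeneous d q \<and>
      (\<Sum>m\<in>S. Poly_Mapping.single m (Poly_Mapping.lookup f m))
        = line_form i j v * q + mconst c * mvar i ^ Suc d"
    \<comment> \<open>Partial sums of \<open>f\<close> keep every monomial in degree
      \<open>Suc d\<close>, which the division of monomials requires.\<close>
    if "finite S" "S \<subseteq> Poly_Mapping.keys f" for S
    using that
  proof (induction S)
    case empty
    show ?case by (intro exI[of _ 0]) simp
  next
    case (insert m S)
    then obtain q c where q: "homogeneous d q"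
      "(\<Sum>m\<in>S. Poly_Mapping.single m (Poly_Mapping.lookup f m))
        = line_form i j v * q + mconst c * mvar i ^ Suc d"
      by auto
    have "Poly_Mapping.lookup m j + Poly_Mapping.lookup m i = Suc d"
      using insert.prems assms(1,2) by (auto simp: homogeneous_def sum_UNIV_2[of j i])
    from monomial_mod_line_form[of v i _ _ _ j, OF assms(3) this] obtain r e where r: "homogeneous d r"
      "mvar j ^ Poly_Mapping.lookup m j * mvar i ^ Poly_Mapping.lookup m i
        = line_form i j v * r + mconst e * mvar i ^ Suc d"
      by blast
    let ?a = "Poly_Mapping.lookup f m"
    have "Poly_Mapping.single m ?a = mconst ?a * (line_form i j v * r + mconst e * mvar i ^ Suc d)"
      using assms(2) r(2) prod_mvar_power[of m, where 'a = 'a]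
      by (subst single_eq_mconst_mult) (simp add: prod_UNIV_2[of j i])
    with q(2) insert.hyps have "(\<Sum>m\<in>insert m S. Poly_Mapping.single m (Poly_Mapping.lookup f m))
        = line_form i j v * (mconst ?a * r + q) + mconst (?a * e + c) * mvar i ^ Suc d"
      by (simp add: mconst_mult mconst_add algebra_simps)
    moreover have "homogeneous d (mconst ?a * r + q)"
      using homogeneous_mult[OF homogeneous_mconst r(1)] q(1) by (intro homogeneous_add) simp_all
    ultimately show ?case by blast
  qed
  from this[of "Poly_Mapping.keys f"] show ?thesis
    by (simp add: mpoly_sum_monomials)
qed

text \<open>At \<open>v\<close> the line form vanishes, so the remainder contributes
  \<open>c * v_i ^ Suc d = 0\<close>. Since \<open>v_i\<close> is nonzero,
  \<open>c = 0\<close>.\<close>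

lemma line_form_factor:
  fixes f :: "(2, 'a::field) mpoly" and v :: "'a ^ 2"
  assumes "homogeneous (Suc d) f" "i \<noteq> j" "v $ i \<noteq> 0" "meval f v = 0"
  obtains q where "homogeneous d q" "f = line_form i j v * q"
proof -
  obtain q c where q: "homogeneous d q" "f = line_form i j v * q + mconst c * mvar i ^ Suc d"
    using homogeneous_mod_line_form[OF assms(1-3)] by blast
  have "meval f v = c * v $ i ^ Suc d"
    by (simp add: q(2) meval_simps meval_line_form del: power_Suc)
  then have "c = 0"
    using assms(3,4) by simp
  then show ?thesis
    using that q by simp
qed

text \<open>Unless \<open>(1, 0)\<close> is a zero, the dehomogenization
  \<open>p(t) = f(t, 1)\<close> has the nonzero coefficient \<open>f(1, 0)\<close> at
  \<open>t^d\<close>. It is then nonconstant and has a root \<open>t\<close>, so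
  \<open>(t, 1)\<close> is a zero.\<close>

lemma binary_form_has_zero:
  fixes f :: "(2, 'a::alg_closed_field) mpoly"
  assumes "homogeneous d f" "d \<ge> 1"
  shows "\<exists>v. v \<noteq> 0 \<and> meval f v = 0"
proof (cases "meval f (vector [1, 0]) = 0")
  case True
  moreover have "vector [1, 0] \<noteq> (0 :: 'a ^ 2)"
    by (simp add: vec_eq_iff forall_2)
  ultimately show ?thesis by blast
next
  case False
  define p where "p = (\<Sum>m\<in>Poly_Mapping.keys f. monom (Poly_Mapping.lookup f m) (Poly_Mapping.lookup m 1))"
  \<comment> \<open>Among monomials of degree \<open>d\<close>, only the pure power of the first
    variable contributes to either side.\<close>
  have "coeff p d = meval f (vector [1, 0])"
    unfolding p_def meval_def coeff_sum
  proof (rule sum.cong)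
    fix m assume "m \<in> Poly_Mapping.keys f"
    then have "Poly_Mapping.lookup m 1 + Poly_Mapping.lookup m 2 = d"
      using assms(1) by (simp add: homogeneous_def sum_2)
    then show "coeff (monom (Poly_Mapping.lookup f m) (Poly_Mapping.lookup m 1)) d =
        Poly_Mapping.lookup f m * (\<Prod>i\<in>UNIV. vector [1, 0] $ i ^ Poly_Mapping.lookup m i)"
      by (auto simp: prod_UNIV_2[of 1 2] power_0_left)
  qed simp
  with False have "degree p \<ge> d"
    by (intro le_degree) simp
  with assms(2) obtain t where "poly p t = 0"
    using alg_closed_imp_poly_has_root[of p] by auto
  moreover have "poly p t = meval f (vector [t, 1])"
    by (simp add: p_def meval_def poly_sum poly_monom prod_UNIV_2[of 1 2])
  moreover have "vector [t, 1] \<noteq> (0 :: 'a ^ 2)"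
    by (simp add: vec_eq_iff forall_2)
  ultimately show ?thesis by metis
qed

section \<open>Vanishing Hessian and repeated linear factors\<close>

lemma meval_euler:
  fixes f :: "(2, 'a::comm_ring_1) mpoly"
  assumes "homogeneous d f"
  shows "v $ 1 * meval (mpderiv 1 f) v + v $ 2 * meval (mpderiv 2 f) v = of_nat d * meval f v"
proof -
  have "(of_nat d :: (2, 'a) mpoly) = mconst (of_nat d)"
    by (simp add: mconst_def)
  then show ?thesis
    using arg_cong[OF euler_homogeneous[OF assms], of "\<lambda>g. meval g v"]
    by (simp add: sum_2 meval_simps)
qed

text \<open>
  If \<open>H\<close> is the Hessian matrix at the zero \<open>v\<close>, Euler's relation gives
  \<open>v\<^sup>T H v = 0\<close> and \<open>H v = (d - 1) \<nabla>f(v)\<close>. A singular symmetric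
  \<open>2 \<times> 2\<close> matrix is a multiple of some \<open>w w\<^sup>T\<close>, so its isotropic vectors
  lie in its kernel; the identity behind this is
  \<open>(a x + b y)\<^sup>2 = a (a x\<^sup>2 + 2 b x y + c y\<^sup>2)\<close> for \<open>a c = b\<^sup>2\<close>.
\<close>

lemma hessian_zero_imp_singular_zero:
  fixes f :: "(2, 'a::field_char_0) mpoly"
  assumes hom: "homogeneous d f" and "d \<ge> 2" "hessian f = 0" "meval f v = 0"
  shows "meval (mpderiv i f) v = 0"
proof -
  obtain e where d: "d = Suc (Suc e)"
    using \<open>d \<ge> 2\<close> by (metis add_2_eq_Suc le_Suc_ex)
  define a where "a = meval (mpderiv 1 (mpderiv 1 f)) v"
  define b where "b = meval (mpderiv 1 (mpderiv 2 f)) v"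
  define c where "c = meval (mpderiv 2 (mpderiv 2 f)) v"
  let ?x = "v $ 1" and ?y = "v $ 2" and ?g = "\<lambda>i. meval (mpderiv i f) v"
  have "meval (hessian f) v = a * c - b * b"
    by (simp add: hessian_def det_2 meval_simps a_def b_def c_def mpderiv_commute[of 2 1])
  then have ac: "a * c = b * b"
    using assms(3) by (simp add: meval_zero)
  have deriv_hom: "homogeneous (Suc e) (mpderiv i f)" for i
    using hom d by (intro homogeneous_mpderiv) simp
  have g1: "?x * a + ?y * b = of_nat (Suc e) * ?g 1"
    using meval_euler[OF deriv_hom[of 1], of v] by (simp add: a_def b_def mpderiv_commute[of 2 1])
  have g2: "?x * b + ?y * c = of_nat (Suc e) * ?g 2"
    using meval_euler[OF deriv_hom[of 2], of v] by (simp add: b_def c_def)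
  have "?x * ?g 1 + ?y * ?g 2 = 0"
    using meval_euler[OF hom, of v] assms(4) by simp
  then have "?x * (of_nat (Suc e) * ?g 1) + ?y * (of_nat (Suc e) * ?g 2) = 0"
    by (metis distrib_left mult.left_commute mult_zero_right)
  then have Q: "?x * (?x * a + ?y * b) + ?y * (?x * b + ?y * c) = 0"
    by (simp only: g1 g2)
  have "(?x * a + ?y * b)\<^sup>2 = a * (?x * (?x * a + ?y * b) + ?y * (?x * b + ?y * c))"
    using ac by algebra
  \<comment> \<open>The square is zero by \<open>Q\<close>, and the Euler factor
    \<open>Suc e = d - 1\<close> is nonzero in characteristic zero, so it cancels.\<close>
  then have 1: "?g 1 = 0"
    using Q g1 by (simp del: of_nat_Suc)
  have "(?x * b + ?y * c)\<^sup>2 = c * (?x * (?x * a + ?y * b) + ?y * (?x * b + ?y * c))"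
    using ac by algebra
  then have 2: "?g 2 = 0"
    using Q g2 by (simp del: of_nat_Suc)
  show ?thesis
    using 1 2 exhaust_2[of i] by auto
qed

text \<open>Write \<open>f = L q\<close> with \<open>L\<close> the line form. Since \<open>L\<close>
  vanishes at \<open>v\<close> and its derivative in \<open>x_j\<close> is the constant
  \<open>v_i\<close>, the derivative of \<open>f\<close> at \<open>v\<close> equals
  \<open>v_i q(v)\<close>. Hence \<open>q(v) = 0\<close> and \<open>L\<close> divides
  \<open>q\<close> as well.\<close>

lemma singular_zero_imp_square_dvd:
  fixes f :: "(2, 'a::field) mpoly" and v :: "'a ^ 2"
  assumes "homogeneous d f" "d \<ge> 2" "i \<noteq> j" "v $ i \<noteq> 0"
    and "meval f v = 0" "meval (mpderiv j f) v = 0"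
  shows "(line_form i j v)\<^sup>2 dvd f"
proof -
  obtain e where d: "d = Suc (Suc e)"
    using \<open>d \<ge> 2\<close> by (metis add_2_eq_Suc le_Suc_ex)
  obtain q where q: "homogeneous (Suc e) q" "f = line_form i j v * q"
    using line_form_factor[of "Suc e" f i j v] assms d by blast
  have "mpderiv j (line_form i j v) = mconst (v $ i)"
    using assms(3) by (simp add: line_form_def mpderiv_diff mpderiv_mult mpderiv_mconst mpderiv_mvar)
  then have "meval (mpderiv j f) v = v $ i * meval q v"
    by (simp add: q(2) mpderiv_mult meval_simps meval_line_form)
  then have "meval q v = 0"
    using assms by simp
  then obtain r where "q = line_form i j v * r"
    using line_form_factor[OF q(1)] assms(3,4) by blast
  then show ?thesis
    by (simp add: q(2) power2_eq_square flip: mult.assoc)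
qed

section \<open>Non-units, and cones as powers of linear forms\<close>

lemma not_dvd_one_if_zero: "meval f v = 0 \<Longrightarrow> \<not> f dvd 1"
  for f :: "('n::finite, 'a::comm_ring_1) mpoly"
  by (metis dvdE meval_mult meval_one mult_zero_left zero_neq_one)

text \<open>After the change of coordinates only one variable can occur, so homogeneity leaves a
  multiple of its \<open>d\<close>-th power; changing back turns that variable into a linear form
  \<open>M\<close>. The zero of \<open>M\<close> at the origin later shows that \<open>M\<close> is
  not a unit.\<close>

lemma cone_imp_power_of_linear_form:
  fixes f :: "(2, 'a::field) mpoly"
  assumes "homogeneous d f" "is_cone f"
  shows "\<exists>c M. f = mconst c * M ^ d \<and> meval M 0 = 0"
proof -
  obtain A :: "'a ^ 2 ^ 2" and i where A: "invertible A" "\<not> depends_on (linear_subst A f) i"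
    using assms(2) by (auto simp: is_cone_def)
  then obtain B where B: "A ** B = mat 1"
    by (auto simp: invertible_def)
  obtain j where ij: "i \<noteq> j"
    by (metis exhaust_2 zero_neq_one)
  let ?g = "linear_subst A f"
  have "m = Poly_Mapping.single j d" if "m \<in> Poly_Mapping.keys ?g" for m
  proof (rule poly_mapping_eqI)
    fix k
    have "Poly_Mapping.lookup m i = 0"
      using A(2) that by (auto simp: depends_on_def)
    moreover have "Poly_Mapping.lookup m i + Poly_Mapping.lookup m j = d"
      using homogeneous_linear_subst[OF assms(1), of A] that ij
      by (auto simp: homogeneous_def sum_UNIV_2[of i j])
    moreover have "k = i \<or> k = j"
      using UNIV_2_eq[OF ij] by auto
    ultimately show "Poly_Mapping.lookup m k = Poly_Mapping.lookup (Poly_Mapping.single j d) k"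
      using ij by (auto simp: lookup_single)
  qed
  then have g: "?g = Poly_Mapping.single (Poly_Mapping.single j d)
      (Poly_Mapping.lookup ?g (Poly_Mapping.single j d))" (is "_ = Poly_Mapping.single _ ?c")
    by (intro poly_mapping_eqI) (auto simp: lookup_single when_def in_keys_iff)
  define M where "M = linear_subst B (mvar j)"
  have "f = linear_subst B ?g"
    by (simp add: linear_subst_linear_subst B linear_subst_mat_1)
  also have "\<dots> = linear_subst B (mconst ?c * mvar j ^ d)"
    by (subst g) (simp add: mvar_power flip: single_eq_mconst_mult)
  also have "\<dots> = mconst ?c * M ^ d"
    by (simp add: M_def linear_subst_mult linear_subst_mconst linear_subst_power)
  finally have "f = mconst ?c * M ^ d" .
  moreover have "meval M 0 = 0"
    by (simp add: M_def linear_subst_mvar meval_simps)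
  ultimately show ?thesis by blast
qed

section \<open>The case of degree one\<close>

lemma line_form_multiple_is_cone:
  fixes v :: "'a::field ^ 2"
  assumes "i \<noteq> j" "v $ i \<noteq> 0"
  shows "is_cone (line_form i j v * mconst c)"
proof -
  \<comment> \<open>Column \<open>i\<close> is \<open>v\<close> and column \<open>j\<close> is the
    unit vector \<open>e_j\<close>, so the determinant is \<open>v_i\<close> up to sign. The line
    form takes the values 0 at \<open>v\<close> and \<open>v_i\<close> at \<open>e_j\<close>; in the
    new coordinates only \<open>x_j\<close> survives.\<close>
  define A :: "'a ^ 2 ^ 2" where
    "A = (\<chi> k l. if l = i then v $ k else if k = j then 1 else 0)"
  have "det A \<noteq> 0"
    using assms exhaust_2[of i] exhaust_2[of j] by (auto simp: det_2 A_def)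
  then have "invertible A"
    by (simp add: invertible_det_nz)
  moreover have "linear_subst A (line_form i j v * mconst c)
      = Poly_Mapping.single (Poly_Mapping.single j 1) (v $ i * c)"
    unfolding single_eq_mconst_mult[of "Poly_Mapping.single j 1"] mvar_def[symmetric]
    using assms(1)
    by (simp add: line_form_def linear_subst_simps sum_UNIV_2[of i j] A_def mconst_mult algebra_simps)
  ultimately show ?thesis
    using assms(1) unfolding is_cone_def depends_on_def
    by (intro exI[of _ A] conjI exI[of _ i]) (auto simp: lookup_single split: if_splits)
qed

lemma zero_locus_line_form_multiple:
  fixes v :: "'a::field ^ 2"
  assumes "i \<noteq> j" "v $ i \<noteq> 0" "c \<noteq> 0"
  shows "zero_locus (line_form i j v * mconst c) = {vec.span {v}}"
proof -
  have zero_iff: "meval (line_form i j v * mconst c) w = 0 \<longleftrightarrow> w \<in> vec.span {v}" for w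
  proof
    assume "meval (line_form i j v * mconst c) w = 0"
    then have *: "v $ i * w $ j = v $ j * w $ i"
      using assms(3) by (simp add: meval_simps meval_line_form)
    \<comment> \<open>Vanishing of the determinant makes \<open>w\<close> proportional to
      \<open>v\<close>; the coordinate \<open>i\<close>, where \<open>v\<close> is nonzero, fixes
      the ratio.\<close>
    have "w $ k = (w $ i / v $ i) * v $ k" for k
    proof -
      have "k = i \<or> k = j"
        using UNIV_2_eq[OF assms(1)] by auto
      then show ?thesis
        using * assms(2) by (auto simp: field_simps)
    qed
    then have "w = (w $ i / v $ i) *s v"
      unfolding vec_eq_iff vector_smult_component by blast
    then show "w \<in> vec.span {v}"
      by (metis rangeI vec.span_singleton)
  next
    assume "w \<in> vec.span {v}"
    then show "meval (line_form i j v * mconst c) w = 0"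
      by (auto simp: vec.span_singleton meval_simps meval_line_form)
  qed
  have "v \<noteq> 0"
    using assms(2) by auto
  \<comment> \<open>Projective points are whole lines, so any nonzero zero \<open>w\<close> must
    represent the same point as \<open>v\<close>.\<close>
  have "vec.span {w} = vec.span {v}" if w: "w \<noteq> 0" "w \<in> vec.span {v}" for w
  proof -
    obtain k where k: "w = k *s v"
      using w(2) by (auto simp: vec.span_singleton)
    with w(1) have "v = (1 / k) *s w"
      by (auto simp: vec_eq_iff)
    then have "v \<in> vec.span {w}"
      by (auto simp: vec.span_singleton)
    with w(2) show ?thesis
      by (simp add: vec.span_eq)
  qed
  then show ?thesis
    using \<open>v \<noteq> 0\<close> by (auto simp: zero_locus_def proj_space_def zero_iff intro: vec.span_base)
qed

text \<open>The first partial derivatives have degree 0, so they are constants and all second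
  derivatives vanish.\<close>

lemma hessian_linear_form:
  fixes f :: "(2, 'a::comm_ring_1) mpoly"
  assumes "homogeneous 1 f"
  shows "hessian f = 0"
proof -
  have "mpderiv i (mpderiv j f) = 0" for i j
    using homogeneous_mpderiv[of 0 f j] assms by (auto simp: homogeneous_0_iff mpderiv_mconst)
  then show ?thesis
    by (simp add: hessian_def det_2)
qed

theorem proposition3p3:
  fixes f :: "(2, 'k::{alg_closed_field, field_char_0}) mpoly"
    and d :: nat
  assumes "d \<ge> 1"
    and "homogeneous d f"
    and reduced: "squarefree f"
  shows "(hessian f = 0 \<longleftrightarrow> is_cone f) \<and>
         (hessian f = 0 \<longrightarrow> d = 1 \<and> (\<exists>P \<in> proj_space. zero_locus f = {P}))"
proof -
  obtain v where v: "v \<noteq> 0" "meval f v = 0"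
    using binary_form_has_zero[OF assms(2,1)] by blast
  then obtain i where i: "v $ i \<noteq> 0"
    by (auto simp: vec_eq_iff)
  obtain j where ij: "i \<noteq> j"
    by (metis exhaust_2 zero_neq_one)
  have hessian_degree: "d = 1" if "hessian f = 0"
  proof (rule ccontr)
    assume "d \<noteq> 1"
    then have "d \<ge> 2"
      using assms(1) by simp
    then have "(line_form i j v)\<^sup>2 dvd f"
      using hessian_zero_imp_singular_zero[OF assms(2) _ that v(2)] assms(2) ij i v(2)
      by (intro singular_zero_imp_square_dvd) auto
    moreover have "\<not> line_form i j v dvd 1"
      by (rule not_dvd_one_if_zero[of _ v]) (simp add: meval_line_form)
    ultimately show False
      using reduced squarefreeD by blast
  qed
  have cone_degree: "d = 1" if "is_cone f"
  proof (rule ccontr)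
    assume "d \<noteq> 1"
    obtain c M where M: "f = mconst c * M ^ d" "meval M 0 = 0"
      using cone_imp_power_of_linear_form[OF assms(2) \<open>is_cone f\<close>] by blast
    \<comment> \<open>Here \<open>d\<close> is at least 2, so the square of \<open>M\<close> divides
      its \<open>d\<close>-th power.\<close>
    have "M\<^sup>2 dvd f"
      using assms(1) \<open>d \<noteq> 1\<close> by (simp add: M(1) dvd_mult le_imp_power_dvd)
    moreover have "\<not> M dvd 1"
      using M(2) by (rule not_dvd_one_if_zero)
    ultimately show False
      using reduced squarefreeD by blast
  qed
  \<comment> \<open>Each side of the equivalence forces \<open>d = 1\<close>, and in degree one both
    sides hold. This proves the equivalence and the supplement together.\<close>
  have linear: "hessian f = 0 \<and> is_cone f \<and> (\<exists>P \<in> proj_space. zero_locus f = {P})" if "d = 1"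
  proof -
    obtain q where "homogeneous 0 q" and q: "f = line_form i j v * q"
      using line_form_factor[of 0 f i j v] assms(2) \<open>d = 1\<close> ij i v(2) by auto
    then obtain c where c: "q = mconst c"
      by (auto simp: homogeneous_0_iff)
    \<comment> \<open>The zero polynomial is divisible by the square of the non-unit 0, so
      squarefreeness makes \<open>f\<close>, and with it \<open>c\<close>, nonzero.\<close>
    have "\<not> (0 :: (2, 'k) mpoly) dvd 1"
      by simp
    then have "f \<noteq> 0"
      using squarefreeD[OF reduced, of 0] by auto
    then have "c \<noteq> 0"
      using q c by auto
    moreover have "vec.span {v} \<in> proj_space"
      using v(1) by (auto simp: proj_space_def)
    moreover have "hessian f = 0"
      using hessian_linear_form assms(2) that by blast
    ultimately show ?thesis
      using line_form_multiple_is_cone[of i j v c, OF ij i]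
        zero_locus_line_form_multiple[of i j v c, OF ij i] q c by auto
  qed
  show ?thesis
    using hessian_degree cone_degree linear by blast
qed

end
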